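(* Let $n\ge 2$, let $A$ be an $n$-ary algebra over a field $k$, with $n$-ary product written $(a_1a_2\cdots a_n)$. Let $T(A)$ be the tensor algebra of the vector space $A$, let $I\subset T(A)$ be the two-sided ideal generated by all elements of the form $a_1\otimes\cdots\otimes a_n-(a_1a_2\cdots a_n)$ with $a_1,\dots,a_n\in A$, let $\mathcal{O}(A)=T(A)/I$, and let $\xi:T(A)\to\mathcal{O}(A)$ be the canonical projection. If the $n$-ary algebra $A$ is associative, then the restriction $\xi|_A:A\to\mathcal{O}(A)$ is an injective homomorphism of $n$-ary algebras, i.e. it is linear, injective, and $\xi((a_1\cdots a_n))=\xi(a_1)\cdots\xi(a_n)$ for all $a_1,\dots,a_n\in A$.
   Context: An $n$-ary algebra over a field $k$ is a $k$-vector space $A$ with a linear map $m:A^{\otimes n}\to A$, written $m(a_1\otimes\cdots\otimes a_n)=(a_1a_2\cdots a_n)$. It is called associative if the product of any $2n-1$ elements is uniquely defined: for all $1\le i,j\le n$, $m\circ(\mathrm{id}\otimes\cdots\otimes m_{(i)}\otimes\cdots\otimes\mathrm{id})=m\circ(\mathrm{id}\otimes\cdots\otimes m_{(j)}\otimes\cdots\otimes\mathrm{id})$ as maps $A^{\otimes(2n-1)}\to A$, where $m_{(i)}$ means that $m$ stands in the $i$-th of the $n$ positions. Here $T(A)=\bigoplus_{k\ge1}A^{\otimes k}$ is the (non-unital) tensor algebra, and $A$ is identified with the degree-one component $A^{\otimes 1}$. Algebras are not required to have a unit. Any ordinary associative algebra is regarded as an $n$-ary algebra via its $n$-fold product. 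*)

theory Defs
  imports Complex_Main "HOL-Library.Poly_Mapping"
begin

section \<open>Non-unital associative algebras over a field\<close>

text \<open>
  The rings of \<open>HOL-Algebra\<close> have a unit, so non-unital algebras get a record of their own.
\<close>

record ('k, 'v) alg =
  acarrier :: "'v set"
  azero :: 'v
  aadd :: "'v \<Rightarrow> 'v \<Rightarrow> 'v"
  asmult :: "'k \<Rightarrow> 'v \<Rightarrow> 'v"
  amult :: "'v \<Rightarrow> 'v \<Rightarrow> 'v"

definition asub :: "('k::field, 'v) alg \<Rightarrow> 'v \<Rightarrow> 'v \<Rightarrow> 'v" where
  "asub B x y = aadd B x (asmult B (- 1) y)"

locale assoc_alg =
  fixes B :: "('k::field, 'v) alg"
  assumes zero_closed: "azero B \<in> acarrier B"
    and add_closed: "\<lbrakk>x \<in> acarrier B; y \<in> acarrier B\<rbrakk> \<Longrightarrow> aadd B x y \<in> acarrier B"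
    and smult_closed: "x \<in> acarrier B \<Longrightarrow> asmult B c x \<in> acarrier B"
    and mult_closed: "\<lbrakk>x \<in> acarrier B; y \<in> acarrier B\<rbrakk> \<Longrightarrow> amult B x y \<in> acarrier B"
    and add_assoc: "\<lbrakk>x \<in> acarrier B; y \<in> acarrier B; z \<in> acarrier B\<rbrakk> \<Longrightarrow>
      aadd B (aadd B x y) z = aadd B x (aadd B y z)"
    and add_commute: "\<lbrakk>x \<in> acarrier B; y \<in> acarrier B\<rbrakk> \<Longrightarrow> aadd B x y = aadd B y x"
    and add_zero: "x \<in> acarrier B \<Longrightarrow> aadd B (azero B) x = x"
    and add_neg: "x \<in> acarrier B \<Longrightarrow> asub B x x = azero B"
    and smult_add: "\<lbrakk>x \<in> acarrier B; y \<in> acarrier B\<rbrakk> \<Longrightarrow>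
      asmult B c (aadd B x y) = aadd B (asmult B c x) (asmult B c y)"
    and add_smult: "x \<in> acarrier B \<Longrightarrow>
      asmult B (c + d) x = aadd B (asmult B c x) (asmult B d x)"
    and smult_smult: "x \<in> acarrier B \<Longrightarrow> asmult B c (asmult B d x) = asmult B (c * d) x"
    and smult_one: "x \<in> acarrier B \<Longrightarrow> asmult B 1 x = x"
    and mult_assoc: "\<lbrakk>x \<in> acarrier B; y \<in> acarrier B; z \<in> acarrier B\<rbrakk> \<Longrightarrow>
      amult B (amult B x y) z = amult B x (amult B y z)"
    and add_mult: "\<lbrakk>x \<in> acarrier B; y \<in> acarrier B; z \<in> acarrier B\<rbrakk> \<Longrightarrow>
      amult B (aadd B x y) z = aadd B (amult B x z) (amult B y z)"
    and mult_add: "\<lbrakk>x \<in> acarrier B; y \<in> acarrier B; z \<in> acarrier B\<rbrakk> \<Longrightarrow>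
      amult B x (aadd B y z) = aadd B (amult B x y) (amult B x z)"
    and smult_mult: "\<lbrakk>x \<in> acarrier B; y \<in> acarrier B\<rbrakk> \<Longrightarrow>
      amult B (asmult B c x) y = asmult B c (amult B x y)"
    and mult_smult: "\<lbrakk>x \<in> acarrier B; y \<in> acarrier B\<rbrakk> \<Longrightarrow>
      amult B x (asmult B c y) = asmult B c (amult B x y)"

text \<open>The value on the empty list is never used.\<close>

fun aprod :: "('k, 'v) alg \<Rightarrow> 'v list \<Rightarrow> 'v" where
  "aprod B [] = azero B"
| "aprod B [x] = x"
| "aprod B (x # y # zs) = amult B x (aprod B (y # zs))"

definition alg_ideal :: "('k, 'v) alg \<Rightarrow> 'v set \<Rightarrow> bool" where
  "alg_ideal B J \<longleftrightarrow> J \<subseteq> acarrier B \<and> azero B \<in> J \<and>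
    (\<forall>x\<in>J. \<forall>y\<in>J. aadd B x y \<in> J) \<and> (\<forall>c. \<forall>x\<in>J. asmult B c x \<in> J) \<and>
    (\<forall>x\<in>J. \<forall>y\<in>acarrier B. amult B x y \<in> J \<and> amult B y x \<in> J)"

definition alg_ideal_gen :: "('k, 'v) alg \<Rightarrow> 'v set \<Rightarrow> 'v set" where
  "alg_ideal_gen B S = \<Inter> {J. alg_ideal B J \<and> S \<subseteq> J}"

definition alg_coset :: "('k, 'v) alg \<Rightarrow> 'v set \<Rightarrow> 'v \<Rightarrow> 'v set" where
  "alg_coset B J x = (\<lambda>j. aadd B x j) ` J"

definition alg_quot :: "('k, 'v) alg \<Rightarrow> 'v set \<Rightarrow> ('k, 'v set) alg" where
  "alg_quot B J =
    \<lparr> acarrier = alg_coset B J ` acarrier B,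
      azero = alg_coset B J (azero B),
      aadd = (\<lambda>X Y. \<Union>x\<in>X. \<Union>y\<in>Y. alg_coset B J (aadd B x y)),
      asmult = (\<lambda>c X. \<Union>x\<in>X. alg_coset B J (asmult B c x)),
      amult = (\<lambda>X Y. \<Union>x\<in>X. \<Union>y\<in>Y. alg_coset B J (amult B x y)) \<rparr>"

lemma alg_ideal_gen_superset: "S \<subseteq> alg_ideal_gen B S"
  by (auto simp: alg_ideal_gen_def)

context assoc_alg
begin

lemma alg_ideal_carrier: "alg_ideal B (acarrier B)"
  by (simp add: alg_ideal_def zero_closed add_closed smult_closed mult_closed)

lemma alg_ideal_gen_ideal:
  assumes "S \<subseteq> acarrier B"
  shows "alg_ideal B (alg_ideal_gen B S)"
proof -
  have "alg_ideal_gen B S \<subseteq> acarrier B"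
    using assms alg_ideal_carrier by (auto simp: alg_ideal_gen_def)
  moreover have "azero B \<in> alg_ideal_gen B S"
    by (auto simp: alg_ideal_gen_def alg_ideal_def)
  moreover have "aadd B x y \<in> alg_ideal_gen B S"
    if "x \<in> alg_ideal_gen B S" "y \<in> alg_ideal_gen B S" for x y
    using that by (auto simp: alg_ideal_gen_def alg_ideal_def)
  moreover have "asmult B c x \<in> alg_ideal_gen B S" if "x \<in> alg_ideal_gen B S" for c x
    using that by (auto simp: alg_ideal_gen_def alg_ideal_def)
  moreover have "amult B x y \<in> alg_ideal_gen B S \<and> amult B y x \<in> alg_ideal_gen B S"
    if "x \<in> alg_ideal_gen B S" "y \<in> acarrier B" for x y
    using that by (auto simp: alg_ideal_gen_def alg_ideal_def)
  ultimately show ?thesis unfolding alg_ideal_def by simp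
qed

lemma add_left_commute:
  "\<lbrakk>x \<in> acarrier B; y \<in> acarrier B; z \<in> acarrier B\<rbrakk> \<Longrightarrow>
    aadd B x (aadd B y z) = aadd B y (aadd B x z)"
  by (metis add_assoc add_commute)

lemma add_zero_right: "x \<in> acarrier B \<Longrightarrow> aadd B x (azero B) = x"
  by (metis add_commute add_zero zero_closed)

lemma add_sub_cancel:
  assumes "x \<in> acarrier B" "y \<in> acarrier B"
  shows "aadd B y (asub B x y) = x"
proof -
  have "aadd B y (asub B x y) = aadd B x (asub B y y)"
    using assms by (simp add: asub_def add_left_commute smult_closed)
  also have "\<dots> = x"
    using assms add_neg add_commute add_zero zero_closed by metis
  finally show ?thesis .
qed

lemma coset_absorb:
  assumes J: "alg_ideal B J" and x: "x \<in> acarrier B" and j: "j \<in> J"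
  shows "alg_coset B J (aadd B x j) = alg_coset B J x"
proof -
  have JB: "J \<subseteq> acarrier B" and Jadd: "\<And>a b. a \<in> J \<Longrightarrow> b \<in> J \<Longrightarrow> aadd B a b \<in> J"
    and Jsm: "\<And>c a. a \<in> J \<Longrightarrow> asmult B c a \<in> J"
    using J by (auto simp: alg_ideal_def)
  show ?thesis
  proof (intro equalityI subsetI)
    fix z assume "z \<in> alg_coset B J (aadd B x j)"
    then obtain i where i: "i \<in> J" "z = aadd B (aadd B x j) i" by (auto simp: alg_coset_def)
    then have "z = aadd B x (aadd B j i)" using JB j x by (auto intro: add_assoc)
    then show "z \<in> alg_coset B J x" using i j Jadd by (auto simp: alg_coset_def)
  next
    fix z assume "z \<in> alg_coset B J x"
    then obtain i where i: "i \<in> J" "z = aadd B x i" by (auto simp: alg_coset_def)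
    have k: "asub B i j \<in> J" using i j Jadd Jsm by (simp add: asub_def)
    have "aadd B (aadd B x j) (asub B i j) = aadd B x (aadd B j (asub B i j))"
      using JB j k x by (auto intro: add_assoc)
    also have "\<dots> = z" using add_sub_cancel[of i j] i j JB by (metis subsetD)
    finally show "z \<in> alg_coset B J (aadd B x j)" using k by (auto simp: alg_coset_def)
  qed
qed

lemma coset_self:
  assumes "alg_ideal B J" "x \<in> acarrier B"
  shows "x \<in> alg_coset B J x"
  using assms add_zero add_commute zero_closed
  by (metis alg_coset_def alg_ideal_def image_eqI)

lemma coset_eq_iff:
  assumes J: "alg_ideal B J" and x: "x \<in> acarrier B" and y: "y \<in> acarrier B"
  shows "alg_coset B J x = alg_coset B J y \<longleftrightarrow> asub B x y \<in> J"
proof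
  have JB: "J \<subseteq> acarrier B" using J by (auto simp: alg_ideal_def)
  assume "alg_coset B J x = alg_coset B J y"
  with coset_self[OF J x] obtain j where j: "j \<in> J" "x = aadd B y j"
    by (auto simp: alg_coset_def)
  have jB: "j \<in> acarrier B" using j JB by auto
  have "asub B x y = aadd B j (asub B y y)"
    unfolding j(2) using y jB
    by (simp add: asub_def add_assoc add_left_commute smult_closed)
  also have "\<dots> = j" using y jB add_neg add_commute add_zero zero_closed by metis
  finally show "asub B x y \<in> J" using j by simp
next
  assume "asub B x y \<in> J"
  from coset_absorb[OF J y this] show "alg_coset B J x = alg_coset B J y"
    using add_sub_cancel[OF x y] by simp
qed

lemma quot_add_coset:
  assumes J: "alg_ideal B J" and x: "x \<in> acarrier B" and y: "y \<in> acarrier B"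
  shows "aadd (alg_quot B J) (alg_coset B J x) (alg_coset B J y) = alg_coset B J (aadd B x y)"
proof -
  have JB: "J \<subseteq> acarrier B" and Jadd: "\<And>a b. a \<in> J \<Longrightarrow> b \<in> J \<Longrightarrow> aadd B a b \<in> J"
    using J by (auto simp: alg_ideal_def)
  have "alg_coset B J (aadd B u v) = alg_coset B J (aadd B x y)"
    if u: "u \<in> alg_coset B J x" and v: "v \<in> alg_coset B J y" for u v
  proof -
    obtain i j where ij: "i \<in> J" "j \<in> J" "u = aadd B x i" "v = aadd B y j"
      using u v by (auto simp: alg_coset_def)
    then have "i \<in> acarrier B" "j \<in> acarrier B" using JB by auto
    then have "aadd B u v = aadd B (aadd B x y) (aadd B i j)"
      using ij(3,4) x y by (simp add: add_assoc add_left_commute add_closed)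
    then show ?thesis using coset_absorb[OF J] Jadd ij x y add_closed by metis
  qed
  then have "\<Union> ((\<lambda>u. \<Union>v\<in>alg_coset B J y. alg_coset B J (aadd B u v)) ` alg_coset B J x)
      = alg_coset B J (aadd B x y)"
    using coset_self[OF J x] coset_self[OF J y] by blast
  then show ?thesis by (simp add: alg_quot_def)
qed

lemma quot_smult_coset:
  assumes J: "alg_ideal B J" and x: "x \<in> acarrier B"
  shows "asmult (alg_quot B J) c (alg_coset B J x) = alg_coset B J (asmult B c x)"
proof -
  have JB: "J \<subseteq> acarrier B" and Jsm: "\<And>a. a \<in> J \<Longrightarrow> asmult B c a \<in> J"
    using J by (auto simp: alg_ideal_def)
  have "alg_coset B J (asmult B c u) = alg_coset B J (asmult B c x)"
    if u: "u \<in> alg_coset B J x" for u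
  proof -
    obtain i where i: "i \<in> J" "u = aadd B x i" using u by (auto simp: alg_coset_def)
    then have "asmult B c u = aadd B (asmult B c x) (asmult B c i)"
      using JB x by (auto intro: smult_add)
    then show ?thesis using coset_absorb[OF J] Jsm i x smult_closed by metis
  qed
  then have "\<Union> ((\<lambda>u. alg_coset B J (asmult B c u)) ` alg_coset B J x)
      = alg_coset B J (asmult B c x)"
    using coset_self[OF J x] by blast
  then show ?thesis by (simp add: alg_quot_def)
qed

lemma quot_mult_coset:
  assumes J: "alg_ideal B J" and x: "x \<in> acarrier B" and y: "y \<in> acarrier B"
  shows "amult (alg_quot B J) (alg_coset B J x) (alg_coset B J y) = alg_coset B J (amult B x y)"
proof -
  have JB: "J \<subseteq> acarrier B" and Jadd: "\<And>a b. a \<in> J \<Longrightarrow> b \<in> J \<Longrightarrow> aadd B a b \<in> J"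
    and Jm: "\<And>a b. a \<in> J \<Longrightarrow> b \<in> acarrier B \<Longrightarrow> amult B a b \<in> J"
      "\<And>a b. a \<in> J \<Longrightarrow> b \<in> acarrier B \<Longrightarrow> amult B b a \<in> J"
    using J by (auto simp: alg_ideal_def)
  have "alg_coset B J (amult B u v) = alg_coset B J (amult B x y)"
    if u: "u \<in> alg_coset B J x" and v: "v \<in> alg_coset B J y" for u v
  proof -
    obtain i j where ij: "i \<in> J" "j \<in> J" "u = aadd B x i" "v = aadd B y j"
      using u v by (auto simp: alg_coset_def)
    then have c: "i \<in> acarrier B" "j \<in> acarrier B" using JB by auto
    have "amult B u v = aadd B (amult B x v) (amult B i v)"
      using ij(3,4) x y c by (simp add: add_mult add_closed)
    also have "amult B x v = aadd B (amult B x y) (amult B x j)"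
      using ij(4) x y c by (simp add: mult_add)
    also have "aadd B (aadd B (amult B x y) (amult B x j)) (amult B i v)
        = aadd B (amult B x y) (aadd B (amult B x j) (amult B i v))"
      using ij(4) x y c by (simp add: add_assoc mult_closed add_closed)
    finally have "amult B u v = aadd B (amult B x y) (aadd B (amult B x j) (amult B i v))" .
    moreover have "aadd B (amult B x j) (amult B i v) \<in> J"
      using ij x y c Jadd Jm add_closed by metis
    ultimately show ?thesis using coset_absorb[OF J] x y mult_closed by metis
  qed
  then have "\<Union> ((\<lambda>u. \<Union>v\<in>alg_coset B J y. alg_coset B J (amult B u v)) ` alg_coset B J x)
      = alg_coset B J (amult B x y)"
    using coset_self[OF J x] coset_self[OF J y] by blast
  then show ?thesis by (simp add: alg_quot_def)
qed

lemma assoc_alg_quot: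
  assumes J: "alg_ideal B J"
  shows "assoc_alg (alg_quot B J)"
proof -
  note q = quot_add_coset[OF J] quot_smult_coset[OF J] quot_mult_coset[OF J]
  note cl = add_closed smult_closed mult_closed zero_closed
  have car: "acarrier (alg_quot B J) = alg_coset B J ` acarrier B"
    and zer: "azero (alg_quot B J) = alg_coset B J (azero B)"
    by (simp_all add: alg_quot_def)
  show ?thesis
    by unfold_locales
      (auto simp: car zer q cl asub_def add_assoc add_zero add_neg[unfolded asub_def]
        smult_add add_smult smult_smult smult_one mult_assoc add_mult mult_add
        smult_mult mult_smult add_commute add_left_commute add_zero_right)
qed

end


section \<open>The non-unital tensor algebra\<close>

text \<open>Words over \<open>'a\<close>, written additively so that \<open>'a word \<Rightarrow>\<^sub>0 'k\<close> is the monoid algebra.\<close>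

datatype 'a word = Word (letters: "'a list")

instantiation word :: (type) monoid_add
begin

definition zero_word :: "'a word" where
  "zero_word = Word []"

definition plus_word :: "'a word \<Rightarrow> 'a word \<Rightarrow> 'a word" where
  "plus_word u v = Word (letters u @ letters v)"

instance
  by standard (auto simp: zero_word_def plus_word_def)

end

abbreviation fscale :: "'k::field \<Rightarrow> ('a word \<Rightarrow>\<^sub>0 'k) \<Rightarrow> ('a word \<Rightarrow>\<^sub>0 'k)" where
  "fscale c \<equiv> Poly_Mapping.map ((*) c)"

abbreviation fword :: "'a list \<Rightarrow> 'a word \<Rightarrow>\<^sub>0 'k::field" where
  "fword as \<equiv> Poly_Mapping.single (Word as) 1"

text \<open>
  The free non-unital algebra on the set \<open>'a\<close>: as a vector space it is the direct sum over
  \<open>k \<ge> 1\<close> of the free vector spaces on the sets of \<open>k\<close>-tuples.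
\<close>

definition free_alg :: "('k::field, 'a word \<Rightarrow>\<^sub>0 'k) alg" where
  "free_alg =
    \<lparr> acarrier = {p. 0 \<notin> Poly_Mapping.keys p},
      azero = 0, aadd = (+), asmult = fscale, amult = (*) \<rparr>"

text \<open>
  The relations defining the tensor power of degree \<open>k\<close> as a quotient of the free vector space
  on \<open>k\<close>-tuples.
\<close>

definition tensor_rels ::
  "('k::field \<Rightarrow> 'a::ab_group_add \<Rightarrow> 'a) \<Rightarrow> nat \<Rightarrow> ('a word \<Rightarrow>\<^sub>0 'k) set" where
  "tensor_rels scale k =
    {fword (us @ (x + y) # vs) - fword (us @ x # vs) - fword (us @ y # vs) | us vs x y.
        length us + length vs + 1 = k} \<union>
    {fword (us @ scale c x # vs) - fscale c (fword (us @ x # vs)) | us vs c x.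
        length us + length vs + 1 = k}"

definition tensor_null ::
  "('k::field \<Rightarrow> 'a::ab_group_add \<Rightarrow> 'a) \<Rightarrow> ('a word \<Rightarrow>\<^sub>0 'k) set" where
  "tensor_null scale = module.span fscale (\<Union>k\<in>{1..}. tensor_rels scale k)"

text \<open>
  \<open>T(A)\<close>, the direct sum of the tensor powers of degree \<open>k \<ge> 1\<close>, formed in all degrees at once;
  the lemma \<open>tensor_null_iff\<close> below shows that the quotient is taken degree by degree.
\<close>

definition tensor_alg ::
  "('k::field \<Rightarrow> 'a::ab_group_add \<Rightarrow> 'a) \<Rightarrow> ('k, ('a word \<Rightarrow>\<^sub>0 'k) set) alg" where
  "tensor_alg scale = alg_quot free_alg (tensor_null scale)"

definition pure_tensor ::
  "('k::field \<Rightarrow> 'a::ab_group_add \<Rightarrow> 'a) \<Rightarrow> 'a list \<Rightarrow> ('a word \<Rightarrow>\<^sub>0 'k) set" where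
  "pure_tensor scale as = alg_coset free_alg (tensor_null scale) (fword as)"

definition tensor_incl ::
  "('k::field \<Rightarrow> 'a::ab_group_add \<Rightarrow> 'a) \<Rightarrow> 'a \<Rightarrow> ('a word \<Rightarrow>\<^sub>0 'k) set" where
  "tensor_incl scale a = pure_tensor scale [a]"

lemma lookup_fscale: "Poly_Mapping.lookup (fscale c p) w = c * Poly_Mapping.lookup p w"
  by (simp add: Poly_Mapping.map.rep_eq when_def)

lemma vector_space_fscale: "vector_space (fscale :: 'k::field \<Rightarrow> ('a word \<Rightarrow>\<^sub>0 'k) \<Rightarrow> _)"
  by unfold_locales
    (auto intro!: poly_mapping_eqI simp: lookup_fscale lookup_add algebra_simps)

interpretation free_vs: vector_space "fscale :: 'k::field \<Rightarrow> ('a word \<Rightarrow>\<^sub>0 'k) \<Rightarrow> _"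
  by (rule vector_space_fscale)

lemma fscale_conv_mult: "fscale c p = Poly_Mapping.single 0 c * p"
  by (rule mult_map_scale_conv_mult)

lemma fscale_mult_left: "fscale c p * q = fscale c (p * q)"
  by (simp add: fscale_conv_mult mult.assoc)

lemma fpoly_induct [case_names single sum]:
  fixes p :: "'a word \<Rightarrow>\<^sub>0 'k::field"
  assumes single: "\<And>w c. P (Poly_Mapping.single w c)"
    and sum: "\<And>p q. P p \<Longrightarrow> P q \<Longrightarrow> P (p + q)"
  shows "P p"
proof -
  have "P (\<Sum>w\<in>W. Poly_Mapping.single w (Poly_Mapping.lookup p w))" if "finite W" for W
    using that
  proof (induct W rule: finite_induct)
    case empty
    show ?case using single[of 0 0] by simp
  next
    case (insert w W)
    then show ?case using single sum by simp
  qed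
  moreover have "p = (\<Sum>w\<in>Poly_Mapping.keys p. Poly_Mapping.single w (Poly_Mapping.lookup p w))"
    by (rule poly_mapping_eqI) (auto simp: lookup_sum lookup_single when_def in_keys_iff)
  ultimately show ?thesis by (metis finite_keys)
qed

lemma single_zero_central:
  "p * Poly_Mapping.single 0 c = Poly_Mapping.single 0 c * (p :: 'a word \<Rightarrow>\<^sub>0 'k::field)"
proof (induct p rule: fpoly_induct)
  case (single k v)
  show ?case unfolding mult_single by (simp add: mult.commute[of c])
next
  case (sum p1 p2)
  then show ?case by (simp add: distrib_left distrib_right)
qed

lemma fscale_mult_right: "p * fscale c q = fscale c (p * q)"
proof -
  have "p * fscale c q = (p * Poly_Mapping.single 0 c) * q"
    by (simp add: fscale_conv_mult mult.assoc)
  also have "\<dots> = Poly_Mapping.single 0 c * (p * q)"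
    unfolding single_zero_central by (rule mult.assoc)
  finally show ?thesis by (simp only: fscale_conv_mult)
qed

lemma word_plus_eq_zero: "u + v = (0 :: 'a word) \<longleftrightarrow> u = 0 \<and> v = 0"
  by (cases u; cases v) (auto simp: plus_word_def zero_word_def)

lemma fword_mult: "fword us * fword vs = (fword (us @ vs) :: 'a word \<Rightarrow>\<^sub>0 'k::field)"
  by (simp add: mult_single plus_word_def)

lemma free_asub: "asub free_alg p q = p - q"
proof -
  have "p + fscale (- 1) q = p - q"
    by (rule poly_mapping_eqI) (simp add: lookup_fscale lookup_add lookup_minus)
  then show ?thesis by (simp add: asub_def free_alg_def)
qed

lemma assoc_alg_free_alg: "assoc_alg (free_alg :: ('k::field, 'a word \<Rightarrow>\<^sub>0 'k) alg)"
proof -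
  have add: "0 \<notin> Poly_Mapping.keys (p + q)"
    if "0 \<notin> Poly_Mapping.keys p" "0 \<notin> Poly_Mapping.keys q" for p q :: "'a word \<Rightarrow>\<^sub>0 'k"
    using that keys_add[of p q] by auto
  have sm: "0 \<notin> Poly_Mapping.keys (fscale c p)"
    if "0 \<notin> Poly_Mapping.keys p" for c and p :: "'a word \<Rightarrow>\<^sub>0 'k"
    using that by (simp add: in_keys_iff lookup_fscale)
  have mu: "0 \<notin> Poly_Mapping.keys (p * q)"
    if "0 \<notin> Poly_Mapping.keys p" for p q :: "'a word \<Rightarrow>\<^sub>0 'k"
  proof
    assume "0 \<in> Poly_Mapping.keys (p * q)"
    then obtain u v where "0 = u + v" "u \<in> Poly_Mapping.keys p"
      using keys_mult[of p q] by blast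
    then show False using that word_plus_eq_zero[of u v] by auto
  qed
  show ?thesis
    apply unfold_locales
    unfolding free_asub
    by (simp_all add: free_alg_def add sm mu algebra_simps free_vs.scale_right_distrib
          free_vs.scale_left_distrib fscale_mult_left fscale_mult_right)
qed

lemma tensor_rels_mult:
  assumes "r \<in> tensor_rels scale k"
  shows "fword ws * r \<in> tensor_rels scale (length ws + k)"
    and "r * fword ws \<in> tensor_rels scale (k + length ws)"
proof -
  from assms consider
    (add) us vs x y where "length us + length vs + 1 = k"
      "r = fword (us @ (x + y) # vs) - fword (us @ x # vs) - fword (us @ y # vs)"
  | (sm) us vs c x where "length us + length vs + 1 = k"
      "r = fword (us @ scale c x # vs) - fscale c (fword (us @ x # vs))"
    unfolding tensor_rels_def by blast
  then have "fword ws * r \<in> tensor_rels scale (length ws + k) \<and>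
      r * fword ws \<in> tensor_rels scale (k + length ws)"
  proof cases
    case add
    have "fword ws * r = fword ((ws @ us) @ (x + y) # vs) - fword ((ws @ us) @ x # vs)
        - fword ((ws @ us) @ y # vs)"
      by (simp add: add(2) right_diff_distrib fword_mult)
    moreover have "r * fword ws = fword (us @ (x + y) # (vs @ ws)) - fword (us @ x # (vs @ ws))
        - fword (us @ y # (vs @ ws))"
      by (simp add: add(2) left_diff_distrib fword_mult)
    moreover have "length (ws @ us) + length vs + 1 = length ws + k"
      "length us + length (vs @ ws) + 1 = k + length ws"
      using add(1) by auto
    ultimately show ?thesis unfolding tensor_rels_def by blast
  next
    case sm
    have "fword ws * r = fword ((ws @ us) @ scale c x # vs) - fscale c (fword ((ws @ us) @ x # vs))"
      unfolding sm(2) right_diff_distrib fscale_mult_right fword_mult by simp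
    moreover have "r * fword ws =
        fword (us @ scale c x # (vs @ ws)) - fscale c (fword (us @ x # (vs @ ws)))"
      unfolding sm(2) left_diff_distrib fscale_mult_left fword_mult by simp
    moreover have "length (ws @ us) + length vs + 1 = length ws + k"
      "length us + length (vs @ ws) + 1 = k + length ws"
      using sm(1) by auto
    ultimately show ?thesis unfolding tensor_rels_def by blast
  qed
  then show "fword ws * r \<in> tensor_rels scale (length ws + k)"
    "r * fword ws \<in> tensor_rels scale (k + length ws)" by auto
qed

lemma single_conv_fword:
  "Poly_Mapping.single w c = fscale c (fword (letters w) :: 'a word \<Rightarrow>\<^sub>0 'k::field)"
  by (cases w) simp

lemma tensor_null_mult_word:
  assumes "p \<in> tensor_null scale"
  shows "fword ws * p \<in> tensor_null scale \<and> p * fword ws \<in> tensor_null scale"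
  using assms unfolding tensor_null_def
proof (induct p rule: free_vs.span_induct_alt)
  case base
  show ?case by (simp add: free_vs.span_zero)
next
  case (step c r p)
  obtain k where k: "k \<ge> 1" "r \<in> tensor_rels scale k" using step(1) by auto
  let ?S = "\<Union>k\<in>{1..}. tensor_rels scale k"
  have "fword ws * r \<in> ?S" "r * fword ws \<in> ?S"
    using tensor_rels_mult[OF k(2), of ws] k(1) by auto
  then show ?case using step(2)
    by (simp add: distrib_left distrib_right fscale_mult_left fscale_mult_right
        free_vs.span_add free_vs.span_scale free_vs.span_base)
qed

lemma tensor_null_mult:
  assumes "p \<in> tensor_null scale"
  shows "q * p \<in> tensor_null scale \<and> p * q \<in> tensor_null scale"
proof (induct q rule: fpoly_induct)
  case (single w c)
  show ?case
    unfolding single_conv_fword[of w c] fscale_mult_left fscale_mult_right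
    using tensor_null_mult_word[OF assms, of "letters w"]
    by (simp add: tensor_null_def free_vs.span_scale)
next
  case (sum q1 q2)
  then show ?case
    by (simp add: tensor_null_def distrib_left distrib_right free_vs.span_add)
qed

lemma fword_in_free_alg: "as \<noteq> [] \<Longrightarrow> fword as \<in> acarrier free_alg"
  by (simp add: free_alg_def zero_word_def)

lemma tensor_null_subset: "tensor_null scale \<subseteq> acarrier free_alg"
  unfolding tensor_null_def
proof (rule free_vs.span_minimal)
  show "free_vs.subspace (acarrier free_alg :: ('a word \<Rightarrow>\<^sub>0 'b) set)"
    by (auto simp: free_vs.subspace_def free_alg_def in_keys_iff lookup_add lookup_fscale)
  show "(\<Union>k\<in>{1..}. tensor_rels scale k) \<subseteq> acarrier free_alg"
    by (auto simp: tensor_rels_def free_alg_def in_keys_iff lookup_minus lookup_fscale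
        lookup_single zero_word_def)
qed

lemma alg_ideal_tensor_null: "alg_ideal free_alg (tensor_null scale)"
  using tensor_null_subset[of scale] tensor_null_mult[of _ scale]
  by (auto simp: alg_ideal_def free_alg_def tensor_null_def free_vs.span_zero
      free_vs.span_add free_vs.span_scale)

lemma assoc_alg_tensor_alg: "assoc_alg (tensor_alg scale)"
  unfolding tensor_alg_def
  by (rule assoc_alg.assoc_alg_quot[OF assoc_alg_free_alg alg_ideal_tensor_null])

lemma pure_tensor_carrier: "as \<noteq> [] \<Longrightarrow> pure_tensor scale as \<in> acarrier (tensor_alg scale)"
  by (simp add: tensor_alg_def alg_quot_def pure_tensor_def fword_in_free_alg)

lemma pure_tensor_mult:
  assumes "us \<noteq> []" "vs \<noteq> []"
  shows "amult (tensor_alg scale) (pure_tensor scale us) (pure_tensor scale vs)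
    = pure_tensor scale (us @ vs)"
  unfolding tensor_alg_def pure_tensor_def
  using assoc_alg.quot_mult_coset[OF assoc_alg_free_alg alg_ideal_tensor_null
      fword_in_free_alg[OF assms(1)] fword_in_free_alg[OF assms(2)], of scale]
  by (simp add: free_alg_def fword_mult)

lemma aprod_tensor_incl:
  assumes "as \<noteq> []"
  shows "aprod (tensor_alg scale) (map (tensor_incl scale) as) = pure_tensor scale as"
  using assms
proof (induct as rule: induct_list012)
  case (3 x y zs)
  then show ?case
    using pure_tensor_mult[of "[x]" "y # zs" scale] by (simp add: tensor_incl_def)
qed (auto simp: tensor_incl_def)

definition fcomp :: "nat \<Rightarrow> ('a word \<Rightarrow>\<^sub>0 'k::field) \<Rightarrow> 'a word \<Rightarrow>\<^sub>0 'k" where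
  "fcomp k p = (\<Sum>w \<in> {w \<in> Poly_Mapping.keys p. length (letters w) = k}.
    Poly_Mapping.single w (Poly_Mapping.lookup p w))"

lemma lookup_fcomp:
  "Poly_Mapping.lookup (fcomp k p) w =
    (if length (letters w) = k then Poly_Mapping.lookup p w else 0)"
  by (auto simp: fcomp_def lookup_sum lookup_single when_def in_keys_iff)

lemma fcomp_add: "fcomp k (p + q) = fcomp k p + fcomp k q"
  by (rule poly_mapping_eqI) (simp add: lookup_fcomp lookup_add)

lemma fcomp_fscale: "fcomp k (fscale c p) = fscale c (fcomp k p)"
  by (rule poly_mapping_eqI) (simp add: lookup_fcomp lookup_fscale)

lemma sum_fcomp:
  assumes p: "p \<in> acarrier free_alg"
  obtains N where "p = (\<Sum>k\<in>{1..N}. fcomp k p)"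
proof
  let ?N = "Max (insert 0 ((length \<circ> letters) ` Poly_Mapping.keys p))"
  show "p = (\<Sum>k\<in>{1..?N}. fcomp k p)"
  proof (rule poly_mapping_eqI)
    fix w
    have "length (letters w) \<in> {1..?N}" if "Poly_Mapping.lookup p w \<noteq> 0"
    proof -
      have w: "w \<in> Poly_Mapping.keys p" using that by (simp add: in_keys_iff)
      then have "w \<noteq> 0" using p by (auto simp: free_alg_def)
      then have "letters w \<noteq> []" by (cases w) (auto simp: zero_word_def)
      then have "1 \<le> length (letters w)" by (cases "letters w") auto
      moreover have "length (letters w) \<le> ?N" using w by (intro Max_ge) auto
      ultimately show ?thesis by simp
    qed
    then show "Poly_Mapping.lookup p w = Poly_Mapping.lookup (\<Sum>k\<in>{1..?N}. fcomp k p) w"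
      by (auto simp: lookup_sum lookup_fcomp)
  qed
qed

lemma fcomp_tensor_rels:
  assumes "r \<in> tensor_rels scale k"
  shows "fcomp l r = (if l = k then r else 0)"
proof -
  have "Poly_Mapping.lookup r w = 0" if "length (letters w) \<noteq> k" for w
    using assms that
    by (cases w) (auto simp: tensor_rels_def lookup_minus lookup_fscale lookup_single when_def)
  then show ?thesis
    by (intro poly_mapping_eqI) (auto simp: lookup_fcomp)
qed

lemma tensor_null_iff:
  assumes p: "p \<in> acarrier free_alg"
  shows "p \<in> tensor_null scale \<longleftrightarrow>
    (\<forall>k\<ge>1. fcomp k p \<in> module.span fscale (tensor_rels scale k))"
proof
  assume "p \<in> tensor_null scale"
  then have "fcomp k p \<in> free_vs.span (tensor_rels scale k)" for k
    unfolding tensor_null_def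
  proof (induct p rule: free_vs.span_induct_alt)
    case base
    show ?case by (simp add: fcomp_def free_vs.span_zero)
  next
    case (step c r p)
    then obtain j where "r \<in> tensor_rels scale j" by auto
    then have "fcomp k r \<in> free_vs.span (tensor_rels scale k)"
      by (auto simp: fcomp_tensor_rels free_vs.span_zero free_vs.span_base)
    then show ?case using step(2)
      by (simp add: fcomp_add fcomp_fscale free_vs.span_add free_vs.span_scale)
  qed
  then show "\<forall>k\<ge>1. fcomp k p \<in> free_vs.span (tensor_rels scale k)" by simp
next
  assume *: "\<forall>k\<ge>1. fcomp k p \<in> free_vs.span (tensor_rels scale k)"
  obtain N where N: "p = (\<Sum>k\<in>{1..N}. fcomp k p)" using sum_fcomp[OF p] .
  have "(\<Sum>k\<in>{1..N}. fcomp k p) \<in> tensor_null scale"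
    unfolding tensor_null_def
  proof (rule free_vs.span_sum)
    fix k assume "k \<in> {1..N}"
    then show "fcomp k p \<in> free_vs.span (\<Union>k\<in>{1..}. tensor_rels scale k)"
      using * free_vs.span_mono[of "tensor_rels scale k" "\<Union>k\<in>{1..}. tensor_rels scale k"]
      by auto
  qed
  then show "p \<in> tensor_null scale" using N by simp
qed


section \<open>\<open>n\<close>-ary algebras and their envelope \<open>\<O>(A)\<close>\<close>

text \<open>
  The vector space \<open>A\<close> is the type \<open>'a\<close> with scalar multiplication \<open>scale\<close>. The linear map from
  the \<open>n\<close>-th tensor power of \<open>A\<close> to \<open>A\<close> is given as a multilinear map, that is, a function on
  lists; its values on lists whose length is not \<open>n\<close> are irrelevant.
\<close>

definition nary_algebra ::
  "nat \<Rightarrow> ('k::field \<Rightarrow> 'a::ab_group_add \<Rightarrow> 'a) \<Rightarrow> ('a list \<Rightarrow> 'a) \<Rightarrow> bool" where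
  "nary_algebra n scale m \<longleftrightarrow> vector_space scale \<and>
    (\<forall>us vs. length us + length vs + 1 = n \<longrightarrow>
      Vector_Spaces.linear scale scale (\<lambda>x. m (us @ x # vs)))"

text \<open>Positions are numbered from \<open>0\<close>.\<close>

definition nary_insert :: "nat \<Rightarrow> ('a list \<Rightarrow> 'a) \<Rightarrow> nat \<Rightarrow> 'a list \<Rightarrow> 'a" where
  "nary_insert n m i as = m (take i as @ m (take n (drop i as)) # drop (i + n) as)"

definition nary_associative :: "nat \<Rightarrow> ('a list \<Rightarrow> 'a) \<Rightarrow> bool" where
  "nary_associative n m \<longleftrightarrow>
    (\<forall>as i j. length as = 2 * n - 1 \<longrightarrow> i < n \<longrightarrow> j < n \<longrightarrow>
      nary_insert n m i as = nary_insert n m j as)"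

definition nary_alg_hom ::
  "nat \<Rightarrow> ('k::field \<Rightarrow> 'a::ab_group_add \<Rightarrow> 'a) \<Rightarrow> ('a list \<Rightarrow> 'a) \<Rightarrow>
    ('k, 'v) alg \<Rightarrow> ('a \<Rightarrow> 'v) \<Rightarrow> bool" where
  "nary_alg_hom n scale m B f \<longleftrightarrow>
    (\<forall>a. f a \<in> acarrier B) \<and>
    (\<forall>a b. f (a + b) = aadd B (f a) (f b)) \<and>
    (\<forall>c a. f (scale c a) = asmult B c (f a)) \<and>
    (\<forall>as. length as = n \<longrightarrow> f (m as) = aprod B (map f as))"

definition envelope_ideal ::
  "nat \<Rightarrow> ('k::field \<Rightarrow> 'a::ab_group_add \<Rightarrow> 'a) \<Rightarrow> ('a list \<Rightarrow> 'a) \<Rightarrow>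
    ('a word \<Rightarrow>\<^sub>0 'k) set set" where
  "envelope_ideal n scale m = alg_ideal_gen (tensor_alg scale)
    {asub (tensor_alg scale) (pure_tensor scale as) (tensor_incl scale (m as)) | as.
      length as = n}"

definition envelope ::
  "nat \<Rightarrow> ('k::field \<Rightarrow> 'a::ab_group_add \<Rightarrow> 'a) \<Rightarrow> ('a list \<Rightarrow> 'a) \<Rightarrow>
    ('k, ('a word \<Rightarrow>\<^sub>0 'k) set set) alg" where
  "envelope n scale m = alg_quot (tensor_alg scale) (envelope_ideal n scale m)"

definition envelope_proj ::
  "nat \<Rightarrow> ('k::field \<Rightarrow> 'a::ab_group_add \<Rightarrow> 'a) \<Rightarrow> ('a list \<Rightarrow> 'a) \<Rightarrow>
    ('a word \<Rightarrow>\<^sub>0 'k) set \<Rightarrow> ('a word \<Rightarrow>\<^sub>0 'k) set set" where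
  "envelope_proj n scale m = alg_coset (tensor_alg scale) (envelope_ideal n scale m)"

lemma alg_ideal_envelope_ideal:
  assumes "n \<ge> 1"
  shows "alg_ideal (tensor_alg scale) (envelope_ideal n scale m)"
proof -
  interpret T: assoc_alg "tensor_alg scale" by (rule assoc_alg_tensor_alg)
  show ?thesis unfolding envelope_ideal_def
  proof (rule T.alg_ideal_gen_ideal, clarify)
    fix as :: "'b list" assume "n = length as"
    then have "as \<noteq> []" using assms by auto
    then show "asub (tensor_alg scale) (pure_tensor scale as) (tensor_incl scale (m as))
        \<in> acarrier (tensor_alg scale)"
      by (simp add: asub_def tensor_incl_def T.add_closed T.smult_closed pure_tensor_carrier)
  qed
qed

lemma assoc_alg_envelope: "n \<ge> 1 \<Longrightarrow> assoc_alg (envelope n scale m)"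
  unfolding envelope_def
  by (rule assoc_alg.assoc_alg_quot[OF assoc_alg_tensor_alg alg_ideal_envelope_ideal])

end

theory Submission
  imports Defs
begin

text \<open>
  Multiplying the first \<open>n\<close> letters of a word over and over again ends in a word of length less
  than \<open>n\<close>. Sending a word to the resulting letter if that length is \<open>1\<close>, and to \<open>0\<close> otherwise,
  gives a linear map \<open>T(A) \<rightarrow> A\<close> that is the identity on \<open>A\<close>. By associativity it does not
  matter which \<open>n\<close> consecutive letters are multiplied first, so the map vanishes on \<open>I\<close>, and
  hence \<open>I\<close> meets \<open>A\<close> only in \<open>0\<close>.
\<close>

section \<open>Iterated products in an \<open>n\<close>-ary algebra\<close>

text \<open>The condition \<open>n < 2\<close> only serves termination.\<close>

function iter_prod :: "nat \<Rightarrow> ('a::zero list \<Rightarrow> 'a) \<Rightarrow> 'a list \<Rightarrow> 'a" where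
  "iter_prod n m w =
    (if length w < n \<or> n < 2 then (case w of [a] \<Rightarrow> a | _ \<Rightarrow> 0)
     else iter_prod n m (m (take n w) # drop n w))"
  by auto
termination by (relation "measure (\<lambda>(n, m, w). length w)") auto

declare iter_prod.simps [simp del]

lemma iter_prod_singleton: "n \<ge> 2 \<Longrightarrow> iter_prod n m [a] = a"
  by (simp add: iter_prod.simps)

lemma iter_prod_short: "length w < n \<Longrightarrow> length w \<noteq> 1 \<Longrightarrow> iter_prod n m w = 0"
  by (auto simp: iter_prod.simps split: list.split)

lemma iter_prod_append:
  "n \<ge> 2 \<Longrightarrow> length us = n \<Longrightarrow> iter_prod n m (us @ vs) = iter_prod n m (m us # vs)"
  by (subst iter_prod.simps) simp

text \<open>By definition the first \<open>n\<close> letters are always multiplied first;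
  associativity moves an inner block to that place. The induction shortens the prefix
  \<open>us\<close>: once \<open>us\<close> has \<open>n\<close> letters of its own, both sides
  begin with the same multiplication.\<close>

lemma iter_prod_contract:
  assumes n: "n \<ge> 2" and assoc: "nary_associative n m" and xs: "length xs = n"
  shows "iter_prod n m (us @ m xs # vs) = iter_prod n m (us @ xs @ vs)"
proof (induct "length us" arbitrary: us rule: less_induct)
  case less
  consider "us = []" | "n \<le> length us"
    | "us \<noteq> []" "length us < n" "n \<le> length us + 1 + length vs"
    | "us \<noteq> []" "length us + 1 + length vs < n"
    by linarith
  then show ?case
  proof cases
    case 1
    then show ?thesis using iter_prod_append[OF n xs] by simp
  next
    case 2
    define p where "p = take n us"
    define q where "q = drop n us"
    have us: "us = p @ q" and p: "length p = n"
      using 2 by (auto simp: p_def q_def)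
    \<comment> \<open>The new prefix \<open>m p # q\<close> has length
      \<open>length us - n + 1\<close>, which is smaller than \<open>length us\<close> because
      \<open>n\<close> is at least 2.\<close>
    have "iter_prod n m ((m p # q) @ m xs # vs) = iter_prod n m ((m p # q) @ xs @ vs)"
      using n p by (intro less) (simp add: us)
    then show ?thesis
      using iter_prod_append[OF n p] by (simp add: us)
  next
    case 3
    \<comment> \<open>\<open>p\<close> completes \<open>us\<close> and the single letter
      \<open>m xs\<close> to \<open>n\<close> letters. Replacing that letter by the block
      \<open>xs\<close> gives exactly the \<open>2 * n - 1\<close> letters to which associativity
      applies.\<close>
    define p where "p = take (n - 1 - length us) vs"
    define q where "q = drop (n - 1 - length us) vs"
    have vs: "vs = p @ q" and p: "length us + 1 + length p = n"
      using 3 by (auto simp: p_def q_def)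
    define as where "as = us @ xs @ p"
    have as: "length as = 2 * n - 1" using p xs by (simp add: as_def)
    have "m (us @ m xs # p) = nary_insert n m (length us) as"
      using xs by (simp add: nary_insert_def as_def)
    \<comment> \<open>The inner product moves from position \<open>length us\<close> to position 0,
      where \<open>iter_prod\<close> takes it.\<close>
    also have "\<dots> = nary_insert n m 0 as"
      using n 3(2) by (intro assoc[unfolded nary_associative_def, rule_format, OF as]) auto
    also have "\<dots> = m (m (take n as) # drop n as)"
      by (simp add: nary_insert_def)
    finally have eq: "m (us @ m xs # p) = m (m (take n as) # drop n as)" .
    have "iter_prod n m (us @ m xs # vs) = iter_prod n m ((us @ m xs # p) @ q)"
      by (simp add: vs)
    also have "\<dots> = iter_prod n m (m (m (take n as) # drop n as) # q)"
      using p by (subst iter_prod_append[OF n]) (auto simp: eq)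
    also have "\<dots> = iter_prod n m ((m (take n as) # drop n as) @ q)"
      using as n by (subst iter_prod_append[OF n]) auto
    also have "\<dots> = iter_prod n m (take n as @ drop n as @ q)"
      using as n by (subst iter_prod_append[OF n]) auto
    also have "take n as @ drop n as @ q = us @ xs @ vs"
      unfolding append_assoc[symmetric] append_take_drop_id by (simp add: as_def vs)
    finally show ?thesis .
  next
    case 4
    define w where "w = us @ xs @ vs"
    have w: "length w = length us + n + length vs" using xs by (simp add: w_def)
    have pos: "length us > 0" using 4 by simp
    \<comment> \<open>One multiplication brings \<open>w\<close> to length
      \<open>length us + 1 + length vs\<close>, the length of the contracted word. This is at least
      2 and below \<open>n\<close>, so both sides are 0.\<close>
    have "iter_prod n m (take n w @ drop n w) = iter_prod n m (m (take n w) # drop n w)"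
      using w by (intro iter_prod_append[OF n]) simp
    also have "\<dots> = 0"
      using w pos 4 by (intro iter_prod_short) auto
    also have "\<dots> = iter_prod n m (us @ m xs # vs)"
      using pos 4 by (intro iter_prod_short[symmetric]) auto
    finally show ?thesis unfolding append_take_drop_id by (simp add: w_def)
  qed
qed

text \<open>Induction on the number of letters other than \<open>x\<close>. If the first
  multiplication does not involve \<open>x\<close>, it leaves a word with fewer other letters; if it
  does, the map is a composite of \<open>m\<close>, linear in \<open>x\<close>, with a smaller
  instance. Words too short to be multiplied give the identity or 0.\<close>

lemma linear_iter_prod:
  assumes n: "n \<ge> 2" and alg: "nary_algebra n scale m"
  shows "Vector_Spaces.linear scale scale (\<lambda>x. iter_prod n m (us @ x # vs))"
proof (induct "length us + length vs" arbitrary: us vs rule: less_induct)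
  case less
  interpret vector_space scale using alg by (simp add: nary_algebra_def)
  interpret pair: vector_space_pair scale scale ..
  consider "us = []" "vs = []" | "length us + 1 + length vs < n" "us \<noteq> [] \<or> vs \<noteq> []"
    | "n \<le> length us" | "length us < n" "n \<le> length us + 1 + length vs"
    by linarith
  then show ?case
  proof cases
    case 1
    then show ?thesis using linear_id n by (simp add: iter_prod_singleton id_def)
  next
    case 2
    have "iter_prod n m (us @ x # vs) = 0" for x
      using 2 by (intro iter_prod_short) auto
    then show ?thesis by (simp add: pair.linear_zero)
  next
    case 3
    have "Vector_Spaces.linear scale scale
        (\<lambda>x. iter_prod n m ((m (take n us) # drop n us) @ x # vs))"
      using 3 n by (intro less) auto
    moreover have "iter_prod n m ((m (take n us) # drop n us) @ x # vs)
        = iter_prod n m (us @ x # vs)" for x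
      using iter_prod_append[OF n, of "take n us" m "drop n us @ x # vs"] 3
      by (simp flip: append_assoc)
    ultimately show ?thesis by simp
  next
    case 4
    define p where "p = take (n - 1 - length us) vs"
    define q where "q = drop (n - 1 - length us) vs"
    have vs: "vs = p @ q" and p: "length us + length p + 1 = n"
      using 4 by (auto simp: p_def q_def)
    \<comment> \<open>\<open>us\<close> and \<open>p\<close> together have \<open>n - 1\<close>
      letters, hence at least one, so fewer letters surround \<open>x\<close> than before.\<close>
    have "Vector_Spaces.linear scale scale (\<lambda>x. iter_prod n m ([] @ x # q))"
      using p n by (intro less) (auto simp: vs)
    moreover have "Vector_Spaces.linear scale scale (\<lambda>x. m (us @ x # p))"
      using alg p by (simp add: nary_algebra_def)
    ultimately have "Vector_Spaces.linear scale scale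
        ((\<lambda>x. iter_prod n m ([] @ x # q)) \<circ> (\<lambda>x. m (us @ x # p)))"
      by (intro Vector_Spaces.linear_compose)
    moreover have "iter_prod n m (us @ x # vs) = iter_prod n m (m (us @ x # p) # q)" for x
      using iter_prod_append[OF n, of "us @ x # p" m q] p by (simp add: vs)
    ultimately show ?thesis by (simp add: o_def)
  qed
qed


section \<open>The evaluation map\<close>

text \<open>The linear extension of \<open>iter_prod\<close> to the whole monoid algebra, with the
  empty word sent to 0. It is set up on representatives; vanishing on \<open>tensor_null\<close> is
  what makes it a map on T(A).\<close>

definition free_eval ::
  "nat \<Rightarrow> ('k::field \<Rightarrow> 'a::ab_group_add \<Rightarrow> 'a) \<Rightarrow> ('a list \<Rightarrow> 'a) \<Rightarrow> ('a word \<Rightarrow>\<^sub>0 'k) \<Rightarrow> 'a" where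
  "free_eval n scale m p =
    (\<Sum>w\<in>Poly_Mapping.keys p. scale (Poly_Mapping.lookup p w) (iter_prod n m (letters w)))"

lemma linear_free_eval:
  fixes scale :: "'k::field \<Rightarrow> 'a::ab_group_add \<Rightarrow> 'a"
  assumes "vector_space scale"
  shows "Vector_Spaces.linear fscale scale (free_eval n scale m)"
proof -
  interpret vector_space scale by fact
  \<comment> \<open>The sum may run over any finite set containing the support, so that elements
    with different supports can be summed over a common set.\<close>
  have superset: "free_eval n scale m p
      = (\<Sum>w\<in>W. scale (Poly_Mapping.lookup p w) (iter_prod n m (letters w)))"
    if "finite W" "Poly_Mapping.keys p \<subseteq> W" for W and p :: "'a word \<Rightarrow>\<^sub>0 'k"
    unfolding free_eval_def using that
    by (intro sum.mono_neutral_left) (auto simp: in_keys_iff)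
  show ?thesis
  proof (unfold Vector_Spaces.linear_iff, intro conjI allI)
    show "vector_space (fscale :: 'k \<Rightarrow> ('a word \<Rightarrow>\<^sub>0 'k) \<Rightarrow> _)" "vector_space scale"
      by (fact vector_space_fscale) fact
  next
    fix p q :: "'a word \<Rightarrow>\<^sub>0 'k"
    let ?W = "Poly_Mapping.keys p \<union> Poly_Mapping.keys q"
    show "free_eval n scale m (p + q) = free_eval n scale m p + free_eval n scale m q"
      using superset[of ?W p] superset[of ?W q] superset[of ?W "p + q"] keys_add[of p q]
      by (simp add: lookup_add scale_left_distrib sum.distrib)
  next
    fix c and p :: "'a word \<Rightarrow>\<^sub>0 'k"
    have "Poly_Mapping.keys (fscale c p) \<subseteq> Poly_Mapping.keys p"
      by (auto simp: in_keys_iff lookup_fscale)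
    then show "free_eval n scale m (fscale c p) = scale c (free_eval n scale m p)"
      using superset[of "Poly_Mapping.keys p" "fscale c p"]
      by (simp add: lookup_fscale free_eval_def scale_sum_right)
  qed
qed

lemma free_eval_fword:
  assumes "vector_space scale"
  shows "free_eval n scale m (fword as) = iter_prod n m as"
proof -
  interpret vector_space scale by fact
  show ?thesis by (simp add: free_eval_def)
qed

text \<open>Each tensor relation expresses additivity or homogeneity in one letter, and
  \<open>iter_prod\<close> is linear in every letter.\<close>

lemma free_eval_tensor_null:
  fixes scale :: "'k::field \<Rightarrow> 'a::ab_group_add \<Rightarrow> 'a"
  assumes n: "n \<ge> 2" and alg: "nary_algebra n scale m" and p: "p \<in> tensor_null scale"
  shows "free_eval n scale m p = 0"
proof -
  have vs: "vector_space scale" using alg by (simp add: nary_algebra_def)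
  interpret e: Vector_Spaces.linear fscale scale "free_eval n scale m"
    by (rule linear_free_eval[OF vs])
  have rel: "free_eval n scale m r = 0" if r: "r \<in> tensor_rels scale k" for r k
  proof -
    from r consider
      (add) us vs x y where
        "r = fword (us @ (x + y) # vs) - fword (us @ x # vs) - fword (us @ y # vs)"
    | (sm) us vs c x where "r = fword (us @ scale c x # vs) - fscale c (fword (us @ x # vs))"
      unfolding tensor_rels_def by blast
    then show ?thesis
    proof cases
      case add
      interpret i: Vector_Spaces.linear scale scale "\<lambda>x. iter_prod n m (us @ x # vs)"
        by (rule linear_iter_prod[OF n alg])
      show ?thesis by (simp add: add e.diff free_eval_fword[OF vs] i.add)
    next
      case sm
      interpret i: Vector_Spaces.linear scale scale "\<lambda>x. iter_prod n m (us @ x # vs)"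
        by (rule linear_iter_prod[OF n alg])
      show ?thesis unfolding sm e.diff e.scale free_eval_fword[OF vs] i.scale by simp
    qed
  qed
  show ?thesis using p unfolding tensor_null_def
  proof (induct p rule: free_vs.span_induct_alt)
    case base
    show ?case by (rule e.zero)
  next
    case (step c r p)
    then show ?case using rel by (auto simp: e.add e.scale)
  qed
qed

section \<open>From the kernel of the evaluation to a two-sided ideal\<close>

text \<open>The largest ideal contained in the kernel of the evaluation map.\<close>

definition eval_ideal ::
  "nat \<Rightarrow> ('k::field \<Rightarrow> 'a::ab_group_add \<Rightarrow> 'a) \<Rightarrow> ('a list \<Rightarrow> 'a) \<Rightarrow> ('a word \<Rightarrow>\<^sub>0 'k) set" where
  "eval_ideal n scale m =
    {p \<in> acarrier free_alg. \<forall>q r. free_eval n scale m (q * p * r) = 0}"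

lemma alg_ideal_eval_ideal:
  fixes scale :: "'k::field \<Rightarrow> 'a::ab_group_add \<Rightarrow> 'a"
  assumes "vector_space scale"
  shows "alg_ideal free_alg (eval_ideal n scale m)"
proof -
  interpret e: Vector_Spaces.linear fscale scale "free_eval n scale m"
    by (rule linear_free_eval[OF assms])
  interpret F: assoc_alg "free_alg :: ('k, 'a word \<Rightarrow>\<^sub>0 'k) alg" by (rule assoc_alg_free_alg)
  have ops: "azero free_alg = (0 :: 'a word \<Rightarrow>\<^sub>0 'k)" "aadd free_alg p q = p + q"
    "asmult free_alg c p = fscale c p" "amult free_alg p q = p * q"
    for p q :: "'a word \<Rightarrow>\<^sub>0 'k" and c
    by (simp_all add: free_alg_def)
  \<comment> \<open>An extra factor \<open>s\<close> is absorbed into \<open>r\<close> or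
    \<open>q\<close>, which are arbitrary.\<close>
  have "free_eval n scale m (q * (p * s) * r) = 0" "free_eval n scale m (q * (s * p) * r) = 0"
    if "\<forall>q r. free_eval n scale m (q * p * r) = 0" for p q r s
    using that[rule_format, of q "s * r"] that[rule_format, of "q * s" r]
    by (simp_all only: mult.assoc)
  moreover have "free_eval n scale m (q * fscale c p * r) = 0"
    if "\<forall>q r. free_eval n scale m (q * p * r) = 0" for p q r c
    unfolding fscale_mult_right fscale_mult_left e.scale using that by simp
  ultimately show ?thesis
    using F.zero_closed F.add_closed F.smult_closed F.mult_closed
    by (auto simp: alg_ideal_def eval_ideal_def ops distrib_left distrib_right e.add e.zero)
qed

text \<open>Multiplication by \<open>q\<close> and \<open>r\<close> stays inside
  \<open>tensor_null\<close>, where the evaluation vanishes. The inclusion makes membership in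
  \<open>eval_ideal\<close> depend only on the class in T(A).\<close>

lemma tensor_null_subset_eval_ideal:
  assumes "n \<ge> 2" "nary_algebra n scale m"
  shows "tensor_null scale \<subseteq> eval_ideal n scale m"
proof
  fix p assume p: "p \<in> tensor_null scale"
  have "q * p * r \<in> tensor_null scale" for q r
    using tensor_null_mult p by blast
  then show "p \<in> eval_ideal n scale m"
    using free_eval_tensor_null[OF assms] subsetD[OF tensor_null_subset p]
    by (auto simp: eval_ideal_def)
qed

text \<open>Take \<open>q = r = 1\<close>: both range over the whole monoid algebra, which contains
  the empty word.\<close>

lemma free_eval_eval_ideal: "p \<in> eval_ideal n scale m \<Longrightarrow> free_eval n scale m p = 0"
  unfolding eval_ideal_def by (metis (mono_tags, lifting) mem_Collect_eq mult_1 mult_1_right)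

text \<open>Between any two words, \<open>as\<close> may be replaced by the letter
  \<open>m as\<close> without changing the value, by \<open>iter_prod_contract\<close>; this is
  where associativity enters. Linearity extends the claim from words to all \<open>q\<close> and
  \<open>r\<close>.\<close>

lemma envelope_rel_in_eval_ideal:
  fixes scale :: "'k::field \<Rightarrow> 'a::ab_group_add \<Rightarrow> 'a"
  assumes n: "n \<ge> 2" and vs: "vector_space scale" and assoc: "nary_associative n m"
    and as: "length as = n"
  shows "fword as - fword [m as] \<in> eval_ideal n scale m"
proof -
  interpret e: Vector_Spaces.linear fscale scale "free_eval n scale m"
    by (rule linear_free_eval[OF vs])
  let ?p = "fword as - fword [m as] :: 'a word \<Rightarrow>\<^sub>0 'k"
  have word: "free_eval n scale m (fword us * ?p * fword ws) = 0" for us ws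
    using iter_prod_contract[OF n assoc as, of us ws]
    by (simp add: right_diff_distrib left_diff_distrib fword_mult e.diff free_eval_fword[OF vs])
  have "free_eval n scale m (fword us * ?p * r) = 0" for us r
  proof (induct r rule: fpoly_induct)
    case (single w c)
    show ?case
      unfolding single_conv_fword[of w c] fscale_mult_right e.scale word by simp
  next
    case (sum r1 r2)
    then show ?case by (simp only: distrib_left e.add) simp
  qed
  note left = this
  have "free_eval n scale m (q * ?p * r) = 0" for q r
  proof (induct q rule: fpoly_induct)
    case (single w c)
    show ?case
      unfolding single_conv_fword[of w c] fscale_mult_left e.scale left by simp
  next
    case (sum q1 q2)
    then show ?case by (simp only: distrib_right e.add) simp
  qed
  moreover have "as \<noteq> []" using as n by auto
  then have "fword as \<in> acarrier (free_alg :: ('k, 'a word \<Rightarrow>\<^sub>0 'k) alg)"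
    "fword [m as] \<in> acarrier (free_alg :: ('k, 'a word \<Rightarrow>\<^sub>0 'k) alg)"
    by (simp_all add: fword_in_free_alg)
  then have "?p \<in> acarrier free_alg"
    by (auto simp: free_alg_def in_keys_iff lookup_minus)
  ultimately show ?thesis by (simp add: eval_ideal_def)
qed


section \<open>Quotients of non-unital algebras\<close>

context assoc_alg
begin

lemma quot_sub_coset:
  assumes "alg_ideal B J" "x \<in> acarrier B" "y \<in> acarrier B"
  shows "asub (alg_quot B J) (alg_coset B J x) (alg_coset B J y) = alg_coset B J (asub B x y)"
  using assms by (simp add: asub_def quot_add_coset quot_smult_coset smult_closed)

text \<open>Every element of the quotient is a coset, so each closure condition lifts to
  \<open>K\<close>.\<close>

lemma alg_ideal_coset_image:
  assumes J: "alg_ideal B J" and K: "alg_ideal B K"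
  shows "alg_ideal (alg_quot B J) (alg_coset B J ` K)"
proof -
  have "acarrier (alg_quot B J) = alg_coset B J ` acarrier B"
    "azero (alg_quot B J) = alg_coset B J (azero B)"
    by (simp_all add: alg_quot_def)
  moreover have "K \<subseteq> acarrier B" using K by (simp add: alg_ideal_def)
  ultimately show ?thesis using K
    unfolding alg_ideal_def
    by (auto simp: subset_iff quot_add_coset[OF J] quot_smult_coset[OF J] quot_mult_coset[OF J])
qed

text \<open>\<open>x\<close> differs from an element of \<open>K\<close> by an element of
  \<open>J\<close>, which also lies in \<open>K\<close>. This brings membership back from the
  quotient to \<open>B\<close>.\<close>

lemma coset_in_coset_image:
  assumes J: "alg_ideal B J" and K: "alg_ideal B K" and JK: "J \<subseteq> K" and x: "x \<in> acarrier B"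
    and mem: "alg_coset B J x \<in> alg_coset B J ` K"
  shows "x \<in> K"
proof -
  obtain y where y: "y \<in> K" "alg_coset B J x = alg_coset B J y" using mem by auto
  have yB: "y \<in> acarrier B" using y K by (auto simp: alg_ideal_def)
  have "asub B x y \<in> K" using coset_eq_iff[OF J x yB] y JK by auto
  then have "aadd B y (asub B x y) \<in> K" using y K by (auto simp: alg_ideal_def)
  then show ?thesis using add_sub_cancel[OF x yB] by simp
qed

lemma aprod_closed: "xs \<noteq> [] \<Longrightarrow> set xs \<subseteq> acarrier B \<Longrightarrow> aprod B xs \<in> acarrier B"
  by (induct xs rule: induct_list012) (auto simp: mult_closed)

lemma aprod_quot:
  assumes J: "alg_ideal B J"
  shows "xs \<noteq> [] \<Longrightarrow> set xs \<subseteq> acarrier B \<Longrightarrow>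
    aprod (alg_quot B J) (map (alg_coset B J) xs) = alg_coset B J (aprod B xs)"
proof (induct xs rule: induct_list012)
  case (3 x y zs)
  then show ?case
    using aprod_closed[of "y # zs"] by (simp add: quot_mult_coset[OF J])
qed auto

end


section \<open>The map from \<open>A\<close> to its envelope\<close>

lemma tensor_incl_carrier: "tensor_incl scale a \<in> acarrier (tensor_alg scale)"
  by (simp add: tensor_incl_def pure_tensor_carrier)

lemma tensor_incl_add:
  fixes scale :: "'k::field \<Rightarrow> 'a::ab_group_add \<Rightarrow> 'a"
  shows "tensor_incl scale (a + b) =
    aadd (tensor_alg scale) (tensor_incl scale a) (tensor_incl scale b)"
proof -
  interpret F: assoc_alg "free_alg :: ('k, 'a word \<Rightarrow>\<^sub>0 'k) alg" by (rule assoc_alg_free_alg)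
  have w: "fword [x] \<in> acarrier (free_alg :: ('k, 'a word \<Rightarrow>\<^sub>0 'k) alg)" for x :: 'a
    by (simp add: fword_in_free_alg)
  \<comment> \<open>The additivity relation of degree 1; the empty lists are written out to match
    the form in \<open>tensor_rels\<close>.\<close>
  have "fword ([] @ (a + b) # []) - fword ([] @ a # []) - fword ([] @ b # [])
      \<in> tensor_rels scale 1"
    unfolding tensor_rels_def by force
  then have "fword [a + b] - aadd free_alg (fword [a]) (fword [b]) \<in> tensor_null scale"
    unfolding tensor_null_def
    by (intro free_vs.span_base) (auto simp: free_alg_def algebra_simps)
  then have "alg_coset free_alg (tensor_null scale) (fword [a + b])
      = alg_coset free_alg (tensor_null scale) (aadd free_alg (fword [a]) (fword [b]))"
    using F.coset_eq_iff[OF alg_ideal_tensor_null w F.add_closed[OF w w]]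
    by (simp add: free_asub)
  then show ?thesis
    unfolding tensor_incl_def pure_tensor_def tensor_alg_def
    by (simp add: F.quot_add_coset[OF alg_ideal_tensor_null w w])
qed

lemma tensor_incl_scale:
  fixes scale :: "'k::field \<Rightarrow> 'a::ab_group_add \<Rightarrow> 'a"
  shows "tensor_incl scale (scale c a) = asmult (tensor_alg scale) c (tensor_incl scale a)"
proof -
  interpret F: assoc_alg "free_alg :: ('k, 'a word \<Rightarrow>\<^sub>0 'k) alg" by (rule assoc_alg_free_alg)
  have w: "fword [x] \<in> acarrier (free_alg :: ('k, 'a word \<Rightarrow>\<^sub>0 'k) alg)" for x :: 'a
    by (simp add: fword_in_free_alg)
  have "fword ([] @ scale c a # []) - fscale c (fword ([] @ a # [])) \<in> tensor_rels scale 1"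
    unfolding tensor_rels_def by force
  then have "fword [scale c a] - asmult free_alg c (fword [a]) \<in> tensor_null scale"
    unfolding tensor_null_def
    by (intro free_vs.span_base UN_I[of 1]) (simp_all add: free_alg_def)
  then have "alg_coset free_alg (tensor_null scale) (fword [scale c a])
      = alg_coset free_alg (tensor_null scale) (asmult free_alg c (fword [a]))"
    using F.coset_eq_iff[OF alg_ideal_tensor_null w F.smult_closed[OF w]]
    by (simp add: free_asub)
  then show ?thesis
    unfolding tensor_incl_def pure_tensor_def tensor_alg_def
    by (simp add: F.quot_smult_coset[OF alg_ideal_tensor_null w])
qed

lemma nary_alg_hom_envelope_proj:
  fixes scale :: "'k::field \<Rightarrow> 'a::ab_group_add \<Rightarrow> 'a"
  assumes n: "n \<ge> 1"
  shows "nary_alg_hom n scale m (envelope n scale m)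
    (\<lambda>a. envelope_proj n scale m (tensor_incl scale a))"
proof -
  interpret T: assoc_alg "tensor_alg scale" by (rule assoc_alg_tensor_alg)
  note I = alg_ideal_envelope_ideal[OF n, of scale m]
  note inc = tensor_incl_carrier[of scale]
  have "envelope_proj n scale m (tensor_incl scale (m as))
      = aprod (envelope n scale m) (map (\<lambda>a. envelope_proj n scale m (tensor_incl scale a)) as)"
    if as: "length as = n" for as
  proof -
    have ne: "as \<noteq> []" using as n by auto
    have "aprod (envelope n scale m) (map (\<lambda>a. envelope_proj n scale m (tensor_incl scale a)) as)
        = envelope_proj n scale m (aprod (tensor_alg scale) (map (tensor_incl scale) as))"
      using T.aprod_quot[OF I, of "map (tensor_incl scale) as"] ne inc
      by (auto simp: envelope_def envelope_proj_def o_def)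
    also have "\<dots> = envelope_proj n scale m (pure_tensor scale as)"
      by (simp add: aprod_tensor_incl[OF ne])
    \<comment> \<open>The difference of the two tensors is one of the generators of
      \<open>envelope_ideal\<close>.\<close>
    also have "\<dots> = envelope_proj n scale m (tensor_incl scale (m as))"
      using alg_ideal_gen_superset as unfolding envelope_proj_def
      by (subst T.coset_eq_iff[OF I pure_tensor_carrier[OF ne] inc])
        (fastforce simp: envelope_ideal_def)
    finally show ?thesis by simp
  qed
  then show ?thesis
    unfolding nary_alg_hom_def
    by (auto simp: envelope_def envelope_proj_def tensor_incl_add tensor_incl_scale
        T.quot_add_coset[OF I inc inc] T.quot_smult_coset[OF I inc])
      (simp add: alg_quot_def inc)
qed

section \<open>Injectivity\<close>

text \<open>The ideal generated by the relations is the smallest one containing them, and the image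
  of \<open>eval_ideal\<close> in T(A) is such an ideal.\<close>

lemma envelope_ideal_subset_eval_ideal:
  fixes scale :: "'k::field \<Rightarrow> 'a::ab_group_add \<Rightarrow> 'a"
  assumes n: "n \<ge> 2" and alg: "nary_algebra n scale m" and assoc: "nary_associative n m"
  shows "envelope_ideal n scale m
    \<subseteq> alg_coset free_alg (tensor_null scale) ` eval_ideal n scale m"
proof -
  have vs: "vector_space scale" using alg by (simp add: nary_algebra_def)
  interpret F: assoc_alg "free_alg :: ('k, 'a word \<Rightarrow>\<^sub>0 'k) alg" by (rule assoc_alg_free_alg)
  have "alg_ideal (tensor_alg scale)
      (alg_coset free_alg (tensor_null scale) ` eval_ideal n scale m)"
    unfolding tensor_alg_def
    by (rule F.alg_ideal_coset_image[OF alg_ideal_tensor_null alg_ideal_eval_ideal[OF vs]])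
  moreover have "asub (tensor_alg scale) (pure_tensor scale as) (tensor_incl scale (m as))
      \<in> alg_coset free_alg (tensor_null scale) ` eval_ideal n scale m"
    if as: "length as = n" for as
  proof -
    have "as \<noteq> []" using as n by auto
    then have "asub (tensor_alg scale) (pure_tensor scale as) (tensor_incl scale (m as))
        = alg_coset free_alg (tensor_null scale) (fword as - fword [m as])"
      unfolding tensor_alg_def tensor_incl_def pure_tensor_def free_asub[symmetric]
      by (intro F.quot_sub_coset alg_ideal_tensor_null fword_in_free_alg) auto
    then show ?thesis using envelope_rel_in_eval_ideal[OF n vs assoc as] by simp
  qed
  ultimately show ?thesis
    unfolding envelope_ideal_def alg_ideal_gen_def by blast
qed

lemma inj_envelope_proj:
  fixes scale :: "'k::field \<Rightarrow> 'a::ab_group_add \<Rightarrow> 'a"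
  assumes n: "n \<ge> 2" and alg: "nary_algebra n scale m" and assoc: "nary_associative n m"
  shows "inj (\<lambda>a. envelope_proj n scale m (tensor_incl scale a))"
proof (rule injI)
  fix a b
  assume eq: "envelope_proj n scale m (tensor_incl scale a)
    = envelope_proj n scale m (tensor_incl scale b)"
  have vs: "vector_space scale" using alg by (simp add: nary_algebra_def)
  interpret e: Vector_Spaces.linear fscale scale "free_eval n scale m"
    by (rule linear_free_eval[OF vs])
  interpret F: assoc_alg "free_alg :: ('k, 'a word \<Rightarrow>\<^sub>0 'k) alg" by (rule assoc_alg_free_alg)
  interpret T: assoc_alg "tensor_alg scale" by (rule assoc_alg_tensor_alg)
  have w: "fword [x] \<in> acarrier (free_alg :: ('k, 'a word \<Rightarrow>\<^sub>0 'k) alg)" for x :: 'a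
    by (simp add: fword_in_free_alg)
  have "alg_ideal (tensor_alg scale) (envelope_ideal n scale m)"
    using n by (intro alg_ideal_envelope_ideal) simp
  then have "asub (tensor_alg scale) (tensor_incl scale a) (tensor_incl scale b)
      \<in> envelope_ideal n scale m"
    using eq by (simp add: envelope_proj_def T.coset_eq_iff tensor_incl_carrier)
  then have "alg_coset free_alg (tensor_null scale) (asub free_alg (fword [a]) (fword [b]))
      \<in> alg_coset free_alg (tensor_null scale) ` eval_ideal n scale m"
    using envelope_ideal_subset_eval_ideal[OF assms]
    by (auto simp: tensor_alg_def tensor_incl_def pure_tensor_def
        F.quot_sub_coset[OF alg_ideal_tensor_null w w])
  \<comment> \<open>The class in T(A) is lifted back to its representative; this is possible because
    \<open>eval_ideal\<close> contains \<open>tensor_null\<close>.\<close>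
  then have "asub free_alg (fword [a]) (fword [b]) \<in> eval_ideal n scale m"
    by (intro F.coset_in_coset_image[OF alg_ideal_tensor_null alg_ideal_eval_ideal[OF vs]
          tensor_null_subset_eval_ideal[OF n alg]])
      (auto simp: asub_def w F.add_closed F.smult_closed)
  then have "free_eval n scale m (fword [a] - fword [b]) = 0"
    unfolding free_asub by (rule free_eval_eval_ideal)
  \<comment> \<open>On words of length 1 the evaluation returns the letter, so the left side is
    \<open>a - b\<close>.\<close>
  then show "a = b"
    by (simp add: e.diff free_eval_fword[OF vs] iter_prod_singleton[OF n])
qed

theorem mainTheorem1:
  fixes n :: nat
    and scale :: "'k::field \<Rightarrow> 'a::ab_group_add \<Rightarrow> 'a"
    and m :: "'a list \<Rightarrow> 'a"
  assumes "n \<ge> 2"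
    and "nary_algebra n scale m"
    and "nary_associative n m"
  shows "nary_alg_hom n scale m (envelope n scale m)
           (\<lambda>a. envelope_proj n scale m (tensor_incl scale a))
       \<and> inj (\<lambda>a. envelope_proj n scale m (tensor_incl scale a))"
proof
  show "nary_alg_hom n scale m (envelope n scale m)
      (\<lambda>a. envelope_proj n scale m (tensor_incl scale a))"
    using assms(1) by (intro nary_alg_hom_envelope_proj) simp
  show "inj (\<lambda>a. envelope_proj n scale m (tensor_incl scale a))"
    by (rule inj_envelope_proj[OF assms])
qed

end
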